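(* Let $f=f_1+f_2$ on $\mathbb{R}^m$ and $g=g_1+g_2$ on $\mathbb{R}^n$, where $f_1:\mathbb{R}^m\to\mathbb{R}\cup\{+\infty\}$ is proper, closed and convex; $f_2:\mathbb{R}^m\to\mathbb{R}$ is convex with $L_{f_2}$-Lipschitz continuous gradient; $g_1:\mathbb{R}^n\to\mathbb{R}\cup\{+\infty\}$ is proper, closed and $\mu_g$-strongly convex ($\mu_g>0$); $g_2:\mathbb{R}^n\to\mathbb{R}$ is convex with $L_{g_2}$-Lipschitz continuous gradient. Let $A\in\mathbb{R}^{p\times m}$, $B\in\mathbb{R}^{p\times n}$, $b\in\mathbb{R}^p$, let $\mathcal{L}(x,y,\lambda)=f(x)+g(y)+\langle\lambda,Ax+By-b\rangle$, and suppose its set of saddle points $\Omega$ is nonempty. Let $\{(x_k,y_k)\}_{k\ge1}$ be generated by Algorithm 1 (described in the context) with parameters $\alpha,\beta,\gamma>0$, and let $(x^*,y^*,\lambda^* )\in\Omega$. Assume $\alpha\le \frac{1}{L_{f_2}}$, $\beta\le\frac{t_1^2}{L_{g_2}}$, and that $\{t_k\}_{k\ge1}\subseteq[1,+\infty)$ is a nondecreasing sequence satisfying, for all $k\ge1$, $$t_{k+1}^2\le t_k^2+t_{k+1}\quad\text{and}\quad t_{k+1}^2\le t_k^2+\frac{\beta\mu_g}{1+\beta\gamma\|B\|^2}\,t_k .$$ Then for all $k\ge1$: $$\mathcal{L}(x_k,y_k,\lambda^* )-\mathcal{L}(x^*,y^*,\lambda^* )\le\frac{\mathcal{E}_1+\frac{\gamma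 t_2^2}{2}\|B(y_1-y^* )\|^2}{t_k^2},$$ $$\|Ax_k+By_k-b\|\le\frac{C_1}{t_k^2},$$ $$|f(x_k)+g(y_k)-f(x^* )-g(y^* )|\le\frac{\mathcal{E}_1+\frac{\gamma t_2^2}{2}\|B(y_1-y^* )\|^2+C_1\|\lambda^*\|}{t_k^2},$$ where $$\mathcal{E}_1=t_1^2\big(\mathcal{L}(x_1,y_1,\lambda^* )-\mathcal{L}(x^*,y^*,\lambda^* )\big)+\frac{1}{2\alpha}\|x_1-x^*\|^2+\frac{t_2^2}{2\beta}\|y_1-y^*\|^2+\frac{1}{2\gamma}\|\lambda_1-\lambda^*\|^2,$$ $$C_1=3t_1^2\|Ax_1+By_1-b\|+\frac{2\|\lambda_1-\lambda^*\|+2\sqrt{2\gamma\mathcal{E}_1+\gamma^2t_2^2\|B(y_1-y^* )\|^2}}{\gamma}.$$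
   Context: Norms are Euclidean (operator norm for matrices). $dom(F)=\{x: F(x)<+\infty\}$; $F$ is proper if $dom(F)\ne\emptyset$; $F$ is closed if $F(x)\le\liminf_{y\to x}F(y)$ for all $x$ and $dom(F)$ is closed. $1/0$ is read as $+\infty$ in step-size bounds. $\mu_g$-strong convexity of $g_1$ means $g_1(y_2)-g_1(y_1)-\langle\xi,y_2-y_1\rangle\ge\frac{\mu_g}{2}\|y_2-y_1\|^2$ for all $y_1,y_2$ and $\xi\in\partial g_1(y_1)$. A saddle point is a triple $(x^*,y^*,\lambda^* )$ with $\mathcal{L}(x^*,y^*,\lambda)\le\mathcal{L}(x^*,y^*,\lambda^* )\le\mathcal{L}(x,y,\lambda^* )$ for all $(x,y,\lambda)$. Algorithm 1 (for $\min f(x)+g(y)$ s.t. $Ax+By=b$). Initialize $x_1=x_0=u_1\in dom(f)$, $y_1=y_0=v_1\in dom(g)$, $\lambda_1\in\mathbb{R}^p$. For $k=1,2,\dots$: - $(\bar x_k,\bar y_k)=(x_k,y_k)+\frac{t_k-1}{t_{k+1}}[(x_k,y_k)-(x_{k-1},y_{k-1})]$; - $x_{k+1}=\arg\min_x\big(f_1(x)+\langle A^T\lambda_k+\nabla f_2(\bar x_k),x\rangle+\frac{\gamma t_{k+1}^2}{2}\|A(x-x_k)+\frac{1}{t_{k+1}}(Ax_k+Bv_k-b)\|^2+\frac{1}{2\alpha}\|x-\bar x_k\|^2\big)$; - $u_{k+1}=x_{k+1}+(t_{k+1}-1)(x_{k+1}-x_k)$; - $\eta_k=\frac{\beta}{t_{k+1}^2+\beta\mu_g(t_{k+1}-1)}$;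 - $y_{k+1}=\arg\min_y\big(g_1(y)+\langle B^T\lambda_k+\nabla g_2(\bar y_k),y\rangle+\frac{1}{2\eta_k}\|y-\bar y_k+\eta_k\mu_g(t_{k+1}-1)(\bar y_k-y_k)\|^2+\frac{\gamma t_{k+1}^2}{2}\|B(y-y_k)+\frac{1}{t_{k+1}}(Au_{k+1}+By_k-b)\|^2\big)$; - $v_{k+1}=y_{k+1}+(t_{k+1}-1)(y_{k+1}-y_k)$; - $\lambda_{k+1}=\lambda_k+\gamma t_{k+1}(Au_{k+1}+Bv_{k+1}-b)$. *)

theory Defs
  imports "HOL-Analysis.Analysis"
begin

definition dom_ext :: "('a \<Rightarrow> ereal) \<Rightarrow> 'a set" where
  "dom_ext F = {x. F x < \<infinity>}"

definition proper_fun :: "('a \<Rightarrow> ereal) \<Rightarrow> bool" where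
  "proper_fun F \<longleftrightarrow> dom_ext F \<noteq> {}"

(* The effective domain is required to be closed, on top of lower semicontinuity. *)
definition closed_fun :: "('a::topological_space \<Rightarrow> ereal) \<Rightarrow> bool" where
  "closed_fun F \<longleftrightarrow> (\<forall>x. F x \<le> Liminf (at x) F) \<and> closed (dom_ext F)"

(* Meant for functions without the value -\<infinity>, so that no sum below is of the form
   \<infinity> - \<infinity>; the library's convex_on covers real-valued functions only. *)
definition convex_fun :: "('a::real_vector \<Rightarrow> ereal) \<Rightarrow> bool" where
  "convex_fun F \<longleftrightarrow>
     (\<forall>x y. \<forall>s\<in>{0..1}. F ((1 - s) *\<^sub>R x + s *\<^sub>R y) \<le> ereal (1 - s) * F x + ereal s * F y)"

(* If F is proper, this set is empty at every x with F x = \<infinity>. *)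
definition subdiff :: "('a::real_inner \<Rightarrow> ereal) \<Rightarrow> 'a \<Rightarrow> 'a set" where
  "subdiff F x = {\<xi>. \<forall>z. F x + ereal (\<xi> \<bullet> (z - x)) \<le> F z}"

(* Convexity has to be part of the definition: the subgradient inequality alone is vacuous
   for functions with empty subdifferential, such as z \<mapsto> - (norm z)^2. *)
definition strongly_convex_fun :: "real \<Rightarrow> ('a::real_inner \<Rightarrow> ereal) \<Rightarrow> bool" where
  "strongly_convex_fun \<mu> F \<longleftrightarrow> convex_fun F \<and>
     (\<forall>y1 y2. \<forall>\<xi>\<in>subdiff F y1.
        F y2 - F y1 - ereal (\<xi> \<bullet> (y2 - y1)) \<ge> ereal (\<mu> / 2 * (norm (y2 - y1))^2))"

definition convex_lipschitz_gradient ::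
  "real \<Rightarrow> ('a::real_inner \<Rightarrow> real) \<Rightarrow> ('a \<Rightarrow> 'a) \<Rightarrow> bool" where
  "convex_lipschitz_gradient L F dF \<longleftrightarrow>
     convex_on UNIV F \<and> (\<forall>x. GDERIV F x :> dF x) \<and> L-lipschitz_on UNIV dF"

definition lagrangian ::
  "(real^'m \<Rightarrow> ereal) \<Rightarrow> (real^'n \<Rightarrow> ereal) \<Rightarrow> real^'m^'p \<Rightarrow> real^'n^'p \<Rightarrow> real^'p
   \<Rightarrow> real^'m \<Rightarrow> real^'n \<Rightarrow> real^'p \<Rightarrow> ereal" where
  "lagrangian f g A B b x y l = f x + g y + ereal (l \<bullet> (A *v x + B *v y - b))"

definition saddle_points ::
  "(real^'m \<Rightarrow> ereal) \<Rightarrow> (real^'n \<Rightarrow> ereal) \<Rightarrow> real^'m^'p \<Rightarrow> real^'n^'p \<Rightarrow> real^'p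
   \<Rightarrow> ((real^'m) \<times> (real^'n) \<times> (real^'p)) set" where
  "saddle_points f g A B b = {(xs, ys, ls). \<forall>x y l.
     lagrangian f g A B b xs ys l \<le> lagrangian f g A B b xs ys ls \<and>
     lagrangian f g A B b xs ys ls \<le> lagrangian f g A B b x y ls}"

definition extrapolate :: "(nat \<Rightarrow> real) \<Rightarrow> (nat \<Rightarrow> 'a::real_vector) \<Rightarrow> nat \<Rightarrow> 'a" where
  "extrapolate t z k = z k + ((t k - 1) / t (k + 1)) *\<^sub>R (z k - z (k - 1))"

definition step_eta :: "real \<Rightarrow> real \<Rightarrow> (nat \<Rightarrow> real) \<Rightarrow> nat \<Rightarrow> real" where
  "step_eta \<beta> \<mu> t k = \<beta> / ((t (k + 1))^2 + \<beta> * \<mu> * (t (k + 1) - 1))"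

(* df2 and dg2 are the gradients of the smooth parts. The entries t 0, u 0, v 0 and l 0
   of the sequences play no role. Both subproblems are strongly convex, so that
   is_arg_min determines the next iterate uniquely. *)
definition algorithm_iterates ::
  "(real^'m \<Rightarrow> ereal) \<Rightarrow> (real^'m \<Rightarrow> real^'m) \<Rightarrow> (real^'n \<Rightarrow> ereal) \<Rightarrow> (real^'n \<Rightarrow> real^'n)
   \<Rightarrow> real^'m^'p \<Rightarrow> real^'n^'p \<Rightarrow> real^'p \<Rightarrow> real \<Rightarrow> real \<Rightarrow> real \<Rightarrow> real \<Rightarrow> (nat \<Rightarrow> real)
   \<Rightarrow> (nat \<Rightarrow> real^'m) \<Rightarrow> (nat \<Rightarrow> real^'n) \<Rightarrow> (nat \<Rightarrow> real^'m) \<Rightarrow> (nat \<Rightarrow> real^'n) \<Rightarrow> (nat \<Rightarrow> real^'p)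
   \<Rightarrow> bool" where
  "algorithm_iterates f1 df2 g1 dg2 A B b \<mu> \<alpha> \<beta> \<gamma> t x y u v l \<longleftrightarrow>
     x 1 \<in> dom_ext f1 \<and> x 0 = x 1 \<and> u 1 = x 1 \<and>
     y 1 \<in> dom_ext g1 \<and> y 0 = y 1 \<and> v 1 = y 1 \<and>
     (\<forall>k\<ge>1.
        is_arg_min
          (\<lambda>z. f1 z + ereal (
             (transpose A *v l k + df2 (extrapolate t x k)) \<bullet> z
             + \<gamma> * (t (k + 1))^2 / 2
               * (norm (A *v (z - x k) + (1 / t (k + 1)) *\<^sub>R (A *v x k + B *v v k - b)))^2
             + 1 / (2 * \<alpha>) * (norm (z - extrapolate t x k))^2))
          (\<lambda>_. True) (x (k + 1)) \<and>
        u (k + 1) = x (k + 1) + (t (k + 1) - 1) *\<^sub>R (x (k + 1) - x k) \<and>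
        is_arg_min
          (\<lambda>z. g1 z + ereal (
             (transpose B *v l k + dg2 (extrapolate t y k)) \<bullet> z
             + 1 / (2 * step_eta \<beta> \<mu> t k)
               * (norm (z - extrapolate t y k
                    + (step_eta \<beta> \<mu> t k * \<mu> * (t (k + 1) - 1)) *\<^sub>R (extrapolate t y k - y k)))^2
             + \<gamma> * (t (k + 1))^2 / 2
               * (norm (B *v (z - y k) + (1 / t (k + 1)) *\<^sub>R (A *v u (k + 1) + B *v y k - b)))^2))
          (\<lambda>_. True) (y (k + 1)) \<and>
        v (k + 1) = y (k + 1) + (t (k + 1) - 1) *\<^sub>R (y (k + 1) - y k) \<and>
        l (k + 1) = l k + (\<gamma> * t (k + 1)) *\<^sub>R (A *v u (k + 1) + B *v v (k + 1) - b))"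

end

theory Submission
  imports Defs
begin

text \<open>
  The proof shows that the Lyapunov function
  \<open>E k = (t k)\<^sup>2 F k + norm (u k - xs)\<^sup>2 / (2 \<alpha>) + (t (k + 1))\<^sup>2 norm (v k - ys)\<^sup>2 / (2 \<beta>)
  + norm (l k - ls)\<^sup>2 / (2 \<gamma>) + \<gamma> (t (k + 1))\<^sup>2 norm (B (v k - ys))\<^sup>2 / 2\<close>
  is nonincreasing, where \<open>F k\<close> is the Lagrangian gap at \<open>ls\<close>. The optimality
  conditions of the two subproblems, tested against the saddle point and against the previous
  iterate, bound the increment of the gap; the inner products telescope through the multiplier
  update, up to the mismatch of \<open>v k\<close> and \<open>v (k + 1)\<close> in the first subproblem, which the last term
  of \<open>E\<close> absorbs. Strong convexity leaves a surplus \<open>\<mu>g t (k + 1) norm (v (k + 1) - ys)\<^sup>2 / 2\<close>,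
  and the second growth condition on \<open>t\<close> is what lets it pay for the growth of the weights \<open>(t (k + 1))\<^sup>2\<close>.
  The feasibility bound comes from the boundedness of \<open>l k - l 1\<close>, which is \<open>\<gamma>\<close> times a weighted
  sum of the residuals.
\<close>

section \<open>Convexity\<close>

text \<open>Restricting \<open>F\<close> to the line through \<open>x\<close> and \<open>z\<close>
  gives a convex function of one real variable; its tangent at \<open>0\<close> is compared with its
  value at \<open>1\<close>.\<close>

lemma convex_on_above_tangent:
  fixes F :: "'a::real_inner \<Rightarrow> real"
  assumes "convex_on UNIV F" "GDERIV F x :> g"
  shows "F x + g \<bullet> (z - x) \<le> F z"
proof -
  define \<phi> where "\<phi> = (\<lambda>s. F (x + s *\<^sub>R (z - x)))"
  have cvx: "convex_on UNIV \<phi>"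
  proof (rule convex_onI)
    fix s a c :: real
    assume "0 < s" "s < 1"
    have "F ((1 - s) *\<^sub>R (x + a *\<^sub>R (z - x)) + s *\<^sub>R (x + c *\<^sub>R (z - x)))
        \<le> (1 - s) * F (x + a *\<^sub>R (z - x)) + s * F (x + c *\<^sub>R (z - x))"
      using convex_onD[OF assms(1), of s] \<open>0 < s\<close> \<open>s < 1\<close> by simp
    moreover have "(1 - s) *\<^sub>R (x + a *\<^sub>R (z - x)) + s *\<^sub>R (x + c *\<^sub>R (z - x))
        = x + ((1 - s) *\<^sub>R a + s *\<^sub>R c) *\<^sub>R (z - x)"
      by (simp add: algebra_simps)
    ultimately show "\<phi> ((1 - s) *\<^sub>R a + s *\<^sub>R c) \<le> (1 - s) * \<phi> a + s * \<phi> c"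
      unfolding \<phi>_def by simp
  qed simp
  have "((\<lambda>s. x + s *\<^sub>R (z - x)) has_derivative (\<lambda>s. s *\<^sub>R (z - x))) (at 0)"
    by (auto intro!: derivative_eq_intros)
  moreover have "(F has_derivative (\<lambda>h. h \<bullet> g)) (at (x + 0 *\<^sub>R (z - x)))"
    using assms(2) by (simp add: gderiv_def)
  ultimately have "(F \<circ> (\<lambda>s. x + s *\<^sub>R (z - x)) has_derivative
      (\<lambda>h. h \<bullet> g) \<circ> (\<lambda>s. s *\<^sub>R (z - x))) (at 0)"
    by (rule diff_chain_at)
  then have "(\<phi> has_real_derivative g \<bullet> (z - x)) (at 0)"
    unfolding \<phi>_def has_field_derivative_def o_def
    by (rule has_derivative_eq_rhs) (auto simp: inner_commute)
  then have "\<phi> 1 \<ge> \<phi> 0 + (g \<bullet> (z - x)) * (1 - 0)"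
    using convex_on_imp_above_tangent[OF cvx, of 0 1 "g \<bullet> (z - x)"]
    by (auto simp: DERIV_subset)
  then show ?thesis unfolding \<phi>_def by simp
qed

text \<open>Along the segment from \<open>x\<close> to \<open>z\<close>, the difference of
  \<open>F\<close> and its quadratic upper model has nonpositive derivative, by Cauchy-Schwarz and
  the Lipschitz bound on \<open>dF\<close>.\<close>

lemma descent_lemma:
  fixes F :: "'a::real_inner \<Rightarrow> real"
  assumes deriv: "\<And>x. GDERIV F x :> dF x" and lip: "L-lipschitz_on UNIV dF"
  shows "F z \<le> F x + dF x \<bullet> (z - x) + L / 2 * (norm (z - x))\<^sup>2"
proof -
  define d where "d = z - x"
  define \<phi> where "\<phi> = (\<lambda>s. F (x + s *\<^sub>R d) - s * (dF x \<bullet> d) - L / 2 * s\<^sup>2 * (norm d)\<^sup>2)"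
  have "\<phi> 1 \<le> \<phi> 0"
  proof (rule DERIV_nonpos_imp_nonincreasing[of 0 1 \<phi>])
    fix s :: real
    assume s: "0 \<le> s" "s \<le> 1"
    have "((\<lambda>s. x + s *\<^sub>R d) has_derivative (\<lambda>h. h *\<^sub>R d)) (at s)"
      by (auto intro!: derivative_eq_intros)
    moreover have "(F has_derivative (\<lambda>h. h \<bullet> dF (x + s *\<^sub>R d))) (at (x + s *\<^sub>R d))"
      using deriv by (simp add: gderiv_def)
    ultimately have "(F \<circ> (\<lambda>s. x + s *\<^sub>R d) has_derivative
        (\<lambda>h. h \<bullet> dF (x + s *\<^sub>R d)) \<circ> (\<lambda>h. h *\<^sub>R d)) (at s)"
      by (rule diff_chain_at)
    then have "((\<lambda>s. F (x + s *\<^sub>R d)) has_real_derivative dF (x + s *\<^sub>R d) \<bullet> d) (at s)"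
      unfolding has_field_derivative_def o_def
      by (rule has_derivative_eq_rhs) (auto simp: inner_commute)
    then have D: "(\<phi> has_real_derivative
        dF (x + s *\<^sub>R d) \<bullet> d - dF x \<bullet> d - L * s * (norm d)\<^sup>2) (at s)"
      unfolding \<phi>_def by (auto intro!: derivative_eq_intros)
    have "(dF (x + s *\<^sub>R d) - dF x) \<bullet> d \<le> norm (dF (x + s *\<^sub>R d) - dF x) * norm d"
      by (rule norm_cauchy_schwarz)
    also have "\<dots> \<le> (L * (s * norm d)) * norm d"
      using lipschitz_onD[OF lip, of "x + s *\<^sub>R d" x] s
      by (intro mult_right_mono) (auto simp: dist_norm)
    finally have "dF (x + s *\<^sub>R d) \<bullet> d - dF x \<bullet> d - L * s * (norm d)\<^sup>2 \<le> 0"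
      by (simp add: inner_diff_left power2_eq_square mult.assoc)
    with D show "\<exists>y. (\<phi> has_real_derivative y) (at s) \<and> y \<le> 0" by blast
  qed simp
  then show ?thesis unfolding \<phi>_def d_def by simp
qed

text \<open>Lets the merely convex block go through the same estimates as the strongly convex one,
  with modulus \<open>0\<close>. If \<open>F\<close> is infinite at both points, the inequality
  holds because \<open>\<infinity> - \<infinity> = \<infinity>\<close> in
  \<open>ereal\<close>.\<close>

lemma strongly_convex_fun_zero:
  assumes "\<forall>z. F z \<noteq> -\<infinity>" "convex_fun F"
  shows "strongly_convex_fun 0 F"
  unfolding strongly_convex_fun_def
proof (intro conjI allI ballI)
  fix y1 y2 \<xi>
  assume "\<xi> \<in> subdiff F y1"
  then have "F y1 + ereal (\<xi> \<bullet> (y2 - y1)) \<le> F y2" by (simp add: subdiff_def)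
  with assms(1) show "ereal (0 / 2 * (norm (y2 - y1))\<^sup>2) \<le> F y2 - F y1 - ereal (\<xi> \<bullet> (y2 - y1))"
    by (cases "F y1"; cases "F y2") (auto simp: zero_ereal_def algebra_simps)
qed (fact assms(2))

section \<open>One proximal step\<close>

text \<open>Fermat's rule for a convex function plus a quadratic with gradient \<open>G\<close> at
  \<open>p\<close>: compare \<open>p\<close> with \<open>p + s *\<^sub>R (z - p)\<close>, use
  convexity of \<open>F\<close>, divide by \<open>s\<close> and let \<open>s\<close> tend to
  \<open>0\<close> from the right.\<close>

lemma arg_min_subgradient:
  fixes F :: "'a::real_inner \<Rightarrow> ereal"
  assumes fin: "\<forall>z. F z \<noteq> -\<infinity>" and proper: "proper_fun F" and cvx: "convex_fun F"
    and min: "is_arg_min (\<lambda>z. F z + ereal (h z)) (\<lambda>_. True) p"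
    and expand: "\<And>d s. h (p + s *\<^sub>R d) = h p + s * (G \<bullet> d) + s\<^sup>2 * Q d"
  shows "F p < \<infinity>" "- G \<in> subdiff F p"
proof -
  have le: "F p + ereal (h p) \<le> F z + ereal (h z)" for z
    using min by (force simp: is_arg_min_def not_less)
  obtain z0 where "F z0 < \<infinity>" using proper by (auto simp: proper_fun_def dom_ext_def)
  with le[of z0] show dom: "F p < \<infinity>" by auto
  have "F p + ereal (- G \<bullet> (z - p)) \<le> F z" for z
  proof (cases "F z < \<infinity>")
    case True
    then obtain c where c: "F z = ereal c" using fin by (cases "F z") auto
    obtain a where a: "F p = ereal a" using dom fin by (cases "F p") auto
    have bound: "a - c \<le> G \<bullet> (z - p) + s * Q (z - p)" if s: "0 < s" "s < 1" for s
    proof -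
      have "F p + ereal (h p) \<le> F (p + s *\<^sub>R (z - p)) + ereal (h (p + s *\<^sub>R (z - p)))"
        by (rule le)
      also have "F (p + s *\<^sub>R (z - p)) \<le> ereal (1 - s) * F p + ereal s * F z"
      proof -
        have "p + s *\<^sub>R (z - p) = (1 - s) *\<^sub>R p + s *\<^sub>R z" by (simp add: algebra_simps)
        then show ?thesis using cvx s unfolding convex_fun_def by auto
      qed
      finally have "a + h p \<le> (1 - s) * a + s * c
          + (h p + s * (G \<bullet> (z - p)) + s\<^sup>2 * Q (z - p))"
        by (simp add: a c expand add_right_mono)
      then have "s * (a - c) \<le> s * (G \<bullet> (z - p) + s * Q (z - p))"
        by (simp add: algebra_simps power2_eq_square)
      with s show ?thesis by simp
    qed
    have "((\<lambda>s. G \<bullet> (z - p) + s * Q (z - p)) \<longlongrightarrow> G \<bullet> (z - p) + 0 * Q (z - p)) (at_right 0)"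
      by (intro tendsto_intros)
    moreover have "eventually (\<lambda>s. a - c \<le> G \<bullet> (z - p) + s * Q (z - p)) (at_right 0)"
      using bound by (auto simp: eventually_at_right_field intro!: exI[of _ 1])
    ultimately have "a - c \<le> G \<bullet> (z - p) + 0 * Q (z - p)"
      by (rule tendsto_lowerbound) simp
    then show ?thesis by (simp add: a c)
  qed simp
  then show "- G \<in> subdiff F p" by (simp add: subdiff_def)
qed

text \<open>Sum of three inequalities: the strong subgradient inequality for \<open>F1\<close> at
  \<open>p\<close>, the descent lemma for \<open>F2\<close> from \<open>zb\<close> to
  \<open>p\<close>, and the tangent of \<open>F2\<close> at \<open>zb\<close> evaluated at
  \<open>z\<close>. In the applications \<open>zb\<close> is the extrapolated point.\<close>

lemma proximal_step:
  fixes F1 :: "'a::real_inner \<Rightarrow> ereal" and F2 :: "'a \<Rightarrow> real"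
  defines "\<phi> \<equiv> \<lambda>z. real_of_ereal (F1 z) + F2 z"
  assumes fin: "\<forall>z. F1 z \<noteq> -\<infinity>" and proper: "proper_fun F1"
    and sc: "strongly_convex_fun \<mu> F1" and smooth: "convex_lipschitz_gradient L F2 dF2"
    and min: "is_arg_min (\<lambda>z. F1 z + ereal (h z)) (\<lambda>_. True) p"
    and expand: "\<And>d s. h (p + s *\<^sub>R d) = h p + s * (G \<bullet> d) + s\<^sup>2 * Q d"
    and z: "F1 z < \<infinity>"
  shows "\<phi> p - \<phi> z \<le> (dF2 zb - G) \<bullet> (p - z) - \<mu> / 2 * (norm (p - z))\<^sup>2 + L / 2 * (norm (p - zb))\<^sup>2"
proof -
  have cvx: "convex_fun F1" using sc by (simp add: strongly_convex_fun_def)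
  note p = arg_min_subgradient[OF fin proper cvx min expand]
  obtain a where a: "F1 p = ereal a" using p(1) fin by (cases "F1 p") auto
  obtain c where c: "F1 z = ereal c" using z fin by (cases "F1 z") auto
  have "ereal (\<mu> / 2 * (norm (z - p))\<^sup>2) \<le> F1 z - F1 p - ereal (- G \<bullet> (z - p))"
    using sc p(2) unfolding strongly_convex_fun_def by blast
  then have 1: "\<mu> / 2 * (norm (p - z))\<^sup>2 \<le> c - a + G \<bullet> (z - p)"
    by (simp add: a c norm_minus_commute)
  have 2: "F2 p \<le> F2 zb + dF2 zb \<bullet> (p - zb) + L / 2 * (norm (p - zb))\<^sup>2"
    using smooth by (intro descent_lemma) (auto simp: convex_lipschitz_gradient_def)
  have 3: "F2 zb + dF2 zb \<bullet> (z - zb) \<le> F2 z"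
    using smooth by (intro convex_on_above_tangent) (auto simp: convex_lipschitz_gradient_def)
  show ?thesis
    using 1 2 3 unfolding \<phi>_def by (simp add: a c inner_diff_left inner_diff_right)
qed

lemma inner_transpose_matrix_vector:
  fixes M :: "real^'n^'p"
  shows "(transpose M *v w) \<bullet> z = w \<bullet> (M *v z)"
  by (simp add: dot_lmul_matrix)

text \<open>Both subproblems have a quadratic part of this shape; the coefficients of
  \<open>s\<close> and \<open>s\<^sup>2\<close> are the \<open>G\<close> and \<open>Q\<close> that
  \<open>arg_min_subgradient\<close> asks for.\<close>

lemma penalty_expansion:
  fixes M :: "real^'n^'p"
  assumes h: "\<And>z. h z = q \<bullet> z + c1 / 2 * (norm (M *v (z - z0) + e))\<^sup>2 + c2 / 2 * (norm (z - zb))\<^sup>2"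
  shows "h (p + s *\<^sub>R d) = h p
      + s * ((q + c1 *\<^sub>R (transpose M *v (M *v (p - z0) + e)) + c2 *\<^sub>R (p - zb)) \<bullet> d)
      + s\<^sup>2 * (c1 / 2 * (norm (M *v d))\<^sup>2 + c2 / 2 * (norm d)\<^sup>2)"
proof -
  have sq: "(norm (w + s *\<^sub>R d'))\<^sup>2 = (norm w)\<^sup>2 + 2 * s * (w \<bullet> d') + s\<^sup>2 * (norm d')\<^sup>2"
    for w d' :: "real^'k"
    unfolding power2_norm_eq_inner
    by (simp add: inner_add_left inner_add_right inner_commute power2_eq_square algebra_simps)
  have "M *v (p + s *\<^sub>R d - z0) + e = (M *v (p - z0) + e) + s *\<^sub>R (M *v d)"
    by (simp add: matrix_vector_mult_diff_distrib matrix_vector_right_distrib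
        matrix_vector_mult_scaleR)
  moreover have "p + s *\<^sub>R d - zb = (p - zb) + s *\<^sub>R d" by simp
  ultimately show ?thesis
    unfolding h
    by (simp only: sq inner_add_left inner_add_right inner_scaleR_left inner_scaleR_right
        inner_transpose_matrix_vector) (simp add: algebra_simps)
qed

text \<open>Clears the denominator of the momentum factor, so that increments of \<open>u\<close>
  and \<open>v\<close> become multiples of the displacement from the extrapolated point.\<close>

lemma scaleR_diff_extrapolate:
  assumes "t (Suc k) \<noteq> 0"
  shows "t (Suc k) *\<^sub>R (a - extrapolate t z k)
    = t (Suc k) *\<^sub>R (a - z k) - (t k - 1) *\<^sub>R (z k - z (k - 1))"
  using assms by (simp add: extrapolate_def scaleR_diff_right scaleR_add_right)

section \<open>Decrease of the Lyapunov function\<close>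

text \<open>Adding \<open>t\<close> times the first bound and \<open>t * (t - 1)\<close> times the second one turns
  \<open>z'\<close> into \<open>w'\<close> in the inner products.\<close>
lemma accelerated_step:
  fixes z z' zs zb w w' \<zeta> :: "'a::real_inner"
  assumes t: "t \<ge> 1" and \<mu>: "\<mu> \<ge> 0" and L: "L \<le> c"
    and w': "w' = z' + (t - 1) *\<^sub>R (z' - z)" and w: "w' - w = t *\<^sub>R (z' - zb)"
    and \<xi>: "\<xi> = - \<zeta> - c *\<^sub>R (z' - zb) - \<mu> *\<^sub>R (w' - z')"
    and bs: "P' - Ps \<le> \<xi> \<bullet> (z' - zs) - \<mu> / 2 * (norm (z' - zs))\<^sup>2 + L / 2 * (norm (z' - zb))\<^sup>2"
    and bz: "P' - P \<le> \<xi> \<bullet> (z' - z) - \<mu> / 2 * (norm (z' - z))\<^sup>2 + L / 2 * (norm (z' - zb))\<^sup>2"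
  shows "t\<^sup>2 * (P' - Ps) - (t\<^sup>2 - t) * (P - Ps)
      \<le> - t * (\<zeta> \<bullet> (w' - zs)) + c / 2 * ((norm (w - zs))\<^sup>2 - (norm (w' - zs))\<^sup>2)
        - \<mu> * t / 2 * (norm (w' - zs))\<^sup>2"
proof -
  define R where "R = L / 2 * (norm (z' - zb))\<^sup>2"
  have w'_zs: "w' - zs = (z' - zs) + (t - 1) *\<^sub>R (z' - z)" by (simp add: w')
  have "(P' - Ps) + (t - 1) * (P' - P)
      \<le> (\<xi> \<bullet> (z' - zs) - \<mu> / 2 * (norm (z' - zs))\<^sup>2 + R)
        + (t - 1) * (\<xi> \<bullet> (z' - z) - \<mu> / 2 * (norm (z' - z))\<^sup>2 + R)"
    using bs bz t unfolding R_def by (intro add_mono mult_left_mono) auto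
  also have "\<dots> \<le> \<xi> \<bullet> (w' - zs) - \<mu> / 2 * (norm (z' - zs))\<^sup>2 + t * R"
  proof -
    \<comment> \<open>The strong convexity term of the comparison with \<open>z\<close> is given up;
      only the one with \<open>zs\<close> is kept.\<close>
    have "0 \<le> (t - 1) * (\<mu> / 2 * (norm (z' - z))\<^sup>2)" using t \<mu> by simp
    then show ?thesis unfolding w'_zs by (simp add: inner_add_right algebra_simps)
  qed
  also have "\<xi> \<bullet> (w' - zs) = - (\<zeta> \<bullet> (w' - zs)) - c * ((z' - zb) \<bullet> (w' - zs))
      - \<mu> * ((w' - z') \<bullet> (w' - zs))"
    unfolding \<xi> by (simp add: inner_diff_left)
  finally have 1: "(P' - Ps) + (t - 1) * (P' - P)
      \<le> - (\<zeta> \<bullet> (w' - zs)) - c * ((z' - zb) \<bullet> (w' - zs)) - \<mu> * ((w' - z') \<bullet> (w' - zs))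
        - \<mu> / 2 * (norm (z' - zs))\<^sup>2 + t * R" .
  have polar: "(a - b) \<bullet> (a - zs) = ((norm (a - b))\<^sup>2 + (norm (a - zs))\<^sup>2 - (norm (b - zs))\<^sup>2) / 2"
    for a b
    by (simp add: power2_norm_eq_inner inner_diff_left inner_diff_right inner_commute)
  \<comment> \<open>This is the purpose of the term \<open>\<mu> *\<^sub>R (w' - z')\<close> in
    \<open>\<xi>\<close>: it moves the strong convexity surplus from \<open>z'\<close> to
    \<open>w'\<close>, the point whose distance to \<open>zs\<close> is tracked.\<close>
  have "- \<mu> * ((w' - z') \<bullet> (w' - zs)) - \<mu> / 2 * (norm (z' - zs))\<^sup>2
      = - \<mu> / 2 * (norm (w' - z'))\<^sup>2 - \<mu> / 2 * (norm (w' - zs))\<^sup>2"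
    unfolding polar by (simp add: field_simps)
  moreover have "0 \<le> \<mu> / 2 * (norm (w' - z'))\<^sup>2" using \<mu> by simp
  ultimately have 2: "(P' - Ps) + (t - 1) * (P' - P)
      \<le> - (\<zeta> \<bullet> (w' - zs)) - c * ((z' - zb) \<bullet> (w' - zs)) - \<mu> / 2 * (norm (w' - zs))\<^sup>2 + t * R"
    using 1 by linarith
  have "t * ((P' - Ps) + (t - 1) * (P' - P))
      \<le> t * (- (\<zeta> \<bullet> (w' - zs)) - c * ((z' - zb) \<bullet> (w' - zs)) - \<mu> / 2 * (norm (w' - zs))\<^sup>2 + t * R)"
    using 2 t by (intro mult_left_mono) auto
  also have "\<dots> = - t * (\<zeta> \<bullet> (w' - zs)) - c * ((w' - w) \<bullet> (w' - zs))
      - \<mu> * t / 2 * (norm (w' - zs))\<^sup>2 + t\<^sup>2 * R"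
    unfolding w by (simp add: algebra_simps power2_eq_square)
  \<comment> \<open>The descent error is absorbed by the square of \<open>norm (w' - w)\<close> that
    polarization of \<open>(w' - w) \<bullet> (w' - zs)\<close> releases.\<close>
  also have "t\<^sup>2 * R \<le> c / 2 * (norm (w' - w))\<^sup>2"
  proof -
    have "t\<^sup>2 * R = L / 2 * (norm (w' - w))\<^sup>2"
      unfolding w R_def using t by (simp add: power_mult_distrib)
    then show ?thesis using L by (simp add: mult_right_mono)
  qed
  also have "- t * (\<zeta> \<bullet> (w' - zs)) - c * ((w' - w) \<bullet> (w' - zs))
      - \<mu> * t / 2 * (norm (w' - zs))\<^sup>2 + c / 2 * (norm (w' - w))\<^sup>2
      = - t * (\<zeta> \<bullet> (w' - zs)) + c / 2 * ((norm (w - zs))\<^sup>2 - (norm (w' - zs))\<^sup>2)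
        - \<mu> * t / 2 * (norm (w' - zs))\<^sup>2"
    unfolding polar by (simp add: field_simps)
  finally show ?thesis by (simp add: algebra_simps power2_eq_square)
qed

text \<open>The two sides differ by \<open>\<gamma> * t\<^sup>2 / 2\<close> times the square of \<open>norm (q' - q - r)\<close>.\<close>
lemma multiplier_step:
  fixes a q q' r l l' ls :: "'a::real_inner"
  assumes \<gamma>: "\<gamma> > 0" and r: "r = a + q'" and l': "l' = l + (\<gamma> * t) *\<^sub>R r"
  shows "t * (ls \<bullet> r - (l' - (\<gamma> * t) *\<^sub>R (q' - q)) \<bullet> a - l' \<bullet> q')
      \<le> 1 / (2 * \<gamma>) * ((norm (l - ls))\<^sup>2 - (norm (l' - ls))\<^sup>2)
        + \<gamma> * t\<^sup>2 / 2 * ((norm q)\<^sup>2 - (norm q')\<^sup>2)"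
proof -
  define k where "k = \<gamma> * t"
  have l: "l - ls = (l' - ls) - k *\<^sub>R r" by (simp add: l' k_def)
  have "1 / (2 * \<gamma>) * ((norm (l - ls))\<^sup>2 - (norm (l' - ls))\<^sup>2)
      = 1 / (2 * \<gamma>) * (k\<^sup>2 * (norm r)\<^sup>2 - 2 * k * ((l' - ls) \<bullet> r))"
    unfolding l power2_norm_eq_inner
    by (simp add: inner_diff_left inner_diff_right inner_commute algebra_simps power2_eq_square)
  also have "\<dots> = \<gamma> * t\<^sup>2 / 2 * (norm r)\<^sup>2 - t * ((l' - ls) \<bullet> r)"
    using \<gamma> by (simp add: k_def field_simps power2_eq_square)
  finally have 1: "1 / (2 * \<gamma>) * ((norm (l - ls))\<^sup>2 - (norm (l' - ls))\<^sup>2)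
      = \<gamma> * t\<^sup>2 / 2 * (norm r)\<^sup>2 - t * ((l' - ls) \<bullet> r)" .
  \<comment> \<open>Since \<open>r = a + q'\<close>, the multiplier \<open>l'\<close> pairs with the
    whole residual, and the lag \<open>q' - q\<close> leaves one cross term with
    \<open>a = r - q'\<close>.\<close>
  have "t * (ls \<bullet> r - (l' - (\<gamma> * t) *\<^sub>R (q' - q)) \<bullet> a - l' \<bullet> q')
      = - t * ((l' - ls) \<bullet> r) + \<gamma> * t\<^sup>2 / 2 * (2 * ((q' - q) \<bullet> (r - q')))"
    by (simp add: r inner_diff_left inner_add_right algebra_simps power2_eq_square)
  moreover have "2 * ((q' - q) \<bullet> (r - q'))
      = (norm r)\<^sup>2 + (norm q)\<^sup>2 - (norm q')\<^sup>2 - (norm (q' - q - r))\<^sup>2"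
    by (simp add: power2_norm_eq_inner inner_diff_left inner_diff_right inner_commute)
  ultimately have "t * (ls \<bullet> r - (l' - (\<gamma> * t) *\<^sub>R (q' - q)) \<bullet> a - l' \<bullet> q')
      = - t * ((l' - ls) \<bullet> r)
        + \<gamma> * t\<^sup>2 / 2 * ((norm r)\<^sup>2 + (norm q)\<^sup>2 - (norm q')\<^sup>2 - (norm (q' - q - r))\<^sup>2)"
    by simp
  also have "\<dots> \<le> - t * ((l' - ls) \<bullet> r) + \<gamma> * t\<^sup>2 / 2 * ((norm r)\<^sup>2 + (norm q)\<^sup>2 - (norm q')\<^sup>2)"
    using \<gamma> by (intro add_left_mono mult_left_mono) auto
  finally show ?thesis unfolding 1 by (simp add: algebra_simps)
qed

section \<open>Feasibility\<close>

text \<open>The partial sums satisfy \<open>S (k + 1) = (1 - a (k + 1)) S k + a (k + 1) (h (k + 1) + S k)\<close>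
  and hence stay in the ball of radius \<open>max (norm (h 1)) C\<close>.\<close>
lemma norm_bound_of_weighted_sums:
  fixes h :: "nat \<Rightarrow> 'a::real_normed_vector"
  assumes a: "\<And>k. k \<ge> 1 \<Longrightarrow> 0 \<le> a k \<and> a k \<le> 1"
    and C: "\<And>k. k \<ge> 1 \<Longrightarrow> norm (h (k + 1) + (\<Sum>j=1..k. a j *\<^sub>R h j)) \<le> C"
    and k: "k \<ge> 1"
  shows "norm (h k) \<le> norm (h 1) + 2 * C"
proof -
  define S where "S k = (\<Sum>j=1..k. a j *\<^sub>R h j)" for k
  have C0: "0 \<le> C" using C[of 1] norm_ge_zero order_trans by blast
  \<comment> \<open>The sum of the two radii serves as an upper bound for their maximum; a further
    \<open>C\<close> for \<open>h k + S (k - 1)\<close> gives the \<open>2 * C\<close> of the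
    conclusion.\<close>
  have S: "norm (S k) \<le> norm (h 1) + C" if "k \<ge> 1" for k
    using that
  proof (induction k rule: dec_induct)
    case base
    have "norm (S 1) = a 1 * norm (h 1)" using a[of 1] by (simp add: S_def)
    also have "\<dots> \<le> 1 * norm (h 1)" using a[of 1] by (intro mult_right_mono) auto
    finally show ?case using C0 by simp
  next
    case (step k)
    define s where "s = a (Suc k)"
    have s: "0 \<le> s" "s \<le> 1" using a[of "Suc k"] by (auto simp: s_def)
    have "S (Suc k) = (1 - s) *\<^sub>R S k + s *\<^sub>R (h (k + 1) + S k)"
      by (simp add: S_def s_def algebra_simps)
    then have "norm (S (Suc k)) \<le> (1 - s) * norm (S k) + s * norm (h (k + 1) + S k)"
      using norm_triangle_ineq[of "(1 - s) *\<^sub>R S k" "s *\<^sub>R (h (k + 1) + S k)"] s by simp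
    also have "\<dots> \<le> (1 - s) * (norm (h 1) + C) + s * (norm (h 1) + C)"
      using step.IH C[OF step.hyps(1)] s
      by (intro add_mono mult_left_mono) (auto simp: S_def intro: order_trans[of _ C])
    finally show ?case by (simp add: algebra_simps)
  qed
  show ?thesis
  proof (cases "k = 1")
    case False
    then obtain j where j: "k = j + 1" "j \<ge> 1" using k by (cases k) auto
    have "h k = (h (j + 1) + S j) - S j" by (simp add: j)
    then have "norm (h k) \<le> norm (h (j + 1) + S j) + norm (S j)"
      using norm_triangle_ineq4 by metis
    also have "\<dots> \<le> C + (norm (h 1) + C)"
      using C[OF j(2)] S[OF j(2)] by (auto simp: S_def)
    finally show ?thesis by simp
  qed (use C0 in simp)
qed

(* The step-size bounds are stated in ereal, where c / 0 = \<infinity> for c > 0.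
   In E1, real_of_ereal is applied to a finite value: x 1 and y 1 lie in the effective domains,
   and the Lagrangian is finite at a saddle point because f1 and g1 are proper. *)
theorem theorem1:
  fixes f f1 :: "real^'m \<Rightarrow> ereal" and f2 :: "real^'m \<Rightarrow> real" and df2 :: "real^'m \<Rightarrow> real^'m"
    and g g1 :: "real^'n \<Rightarrow> ereal" and g2 :: "real^'n \<Rightarrow> real" and dg2 :: "real^'n \<Rightarrow> real^'n"
    and A :: "real^'m^'p" and B :: "real^'n^'p" and b :: "real^'p"
    and Lf2 Lg2 \<mu>g \<alpha> \<beta> \<gamma> E1 C1 :: real
    and t :: "nat \<Rightarrow> real"
    and x u :: "nat \<Rightarrow> real^'m" and y v :: "nat \<Rightarrow> real^'n" and l :: "nat \<Rightarrow> real^'p"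
    and xs :: "real^'m" and ys :: "real^'n" and ls :: "real^'p"
  assumes f_def: "f = (\<lambda>z. f1 z + ereal (f2 z))"
    and g_def: "g = (\<lambda>z. g1 z + ereal (g2 z))"
    and f1: "\<forall>z. f1 z \<noteq> -\<infinity>" "proper_fun f1" "closed_fun f1" "convex_fun f1"
    and f2: "convex_lipschitz_gradient Lf2 f2 df2"
    and g1: "\<forall>z. g1 z \<noteq> -\<infinity>" "proper_fun g1" "closed_fun g1" "strongly_convex_fun \<mu>g g1"
    and \<mu>g: "\<mu>g > 0"
    and g2: "convex_lipschitz_gradient Lg2 g2 dg2"
    and params: "\<alpha> > 0" "\<beta> > 0" "\<gamma> > 0"
    and iterates: "algorithm_iterates f1 df2 g1 dg2 A B b \<mu>g \<alpha> \<beta> \<gamma> t x y u v l"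
    and nonempty: "saddle_points f g A B b \<noteq> {}"
    and saddle: "(xs, ys, ls) \<in> saddle_points f g A B b"
    and alpha: "ereal \<alpha> \<le> 1 / ereal Lf2"
    and beta: "ereal \<beta> \<le> ereal ((t 1)^2) / ereal Lg2"
    and t_ge_1: "\<forall>k\<ge>1. t k \<ge> 1"
    and t_mono: "mono_on {1..} t"
    and t_step1: "\<forall>k\<ge>1. (t (k + 1))^2 \<le> (t k)^2 + t (k + 1)"
    and t_step2: "\<forall>k\<ge>1. (t (k + 1))^2
        \<le> (t k)^2 + \<beta> * \<mu>g / (1 + \<beta> * \<gamma> * (onorm ((*v) B))^2) * t k"
    and E1_def: "E1 =
        (t 1)^2 * real_of_ereal (lagrangian f g A B b (x 1) (y 1) ls - lagrangian f g A B b xs ys ls)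
        + 1 / (2 * \<alpha>) * (norm (x 1 - xs))^2
        + (t 2)^2 / (2 * \<beta>) * (norm (y 1 - ys))^2
        + 1 / (2 * \<gamma>) * (norm (l 1 - ls))^2"
    and C1_def: "C1 =
        3 * (t 1)^2 * norm (A *v x 1 + B *v y 1 - b)
        + (2 * norm (l 1 - ls)
           + 2 * sqrt (2 * \<gamma> * E1 + \<gamma>^2 * (t 2)^2 * (norm (B *v (y 1 - ys)))^2)) / \<gamma>"
  shows "\<forall>k\<ge>1.
      lagrangian f g A B b (x k) (y k) ls - lagrangian f g A B b xs ys ls
        \<le> ereal ((E1 + \<gamma> * (t 2)^2 / 2 * (norm (B *v (y 1 - ys)))^2) / (t k)^2) \<and>
      norm (A *v x k + B *v y k - b) \<le> C1 / (t k)^2 \<and>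
      \<bar>f (x k) + g (y k) - f xs - g ys\<bar>
        \<le> ereal ((E1 + \<gamma> * (t 2)^2 / 2 * (norm (B *v (y 1 - ys)))^2 + C1 * norm ls) / (t k)^2)"
proof -

  \<comment> \<open>Notation and recursions of the iterates\<close>
  define \<phi> where "\<phi> = (\<lambda>z. real_of_ereal (f1 z) + f2 z)"
  define \<psi> where "\<psi> = (\<lambda>z. real_of_ereal (g1 z) + g2 z)"
  define w where "w k = A *v x k + B *v y k - b" for k
  define r where "r k = A *v u k + B *v v k - b" for k
  have x1: "f1 (x 1) < \<infinity>" and y1: "g1 (y 1) < \<infinity>"
    using iterates by (auto simp: algorithm_iterates_def dom_ext_def)
  have init: "x 0 = x 1" "u 1 = x 1" "y 0 = y 1" "v 1 = y 1"
    using iterates by (auto simp: algorithm_iterates_def)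
  have sc: "strongly_convex_fun 0 f1" using strongly_convex_fun_zero f1 by blast
  have cvx: "convex_fun g1" using g1(4) by (simp add: strongly_convex_fun_def)
  note mult_simps = matrix_vector_mult_diff_distrib matrix_vector_right_distrib
    matrix_vector_mult_scaleR

  have u_succ: "u (k + 1) = x (k + 1) + (t (k + 1) - 1) *\<^sub>R (x (k + 1) - x k)"
    and v_succ: "v (k + 1) = y (k + 1) + (t (k + 1) - 1) *\<^sub>R (y (k + 1) - y k)"
    and l_succ: "l (k + 1) = l k + (\<gamma> * t (k + 1)) *\<^sub>R r (k + 1)" if "k \<ge> 1" for k
    using iterates that by (auto simp: algorithm_iterates_def r_def)
  have t1: "t k \<ge> 1" if "k \<ge> 1" for k using t_ge_1 that by blast
  \<comment> \<open>At \<open>k = 1\<close> the momentum term vanishes because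
    \<open>x 0 = x 1\<close>, so the recursion is valid from the first index on; likewise for
    \<open>v\<close>.\<close>
  have u_eq: "u k = x k + (t k - 1) *\<^sub>R (x k - x (k - 1))" if "k \<ge> 1" for k
    using that u_succ[of "k - 1"] init by (cases "k = 1") auto
  have v_eq: "v k = y k + (t k - 1) *\<^sub>R (y k - y (k - 1))" if "k \<ge> 1" for k
    using that v_succ[of "k - 1"] init by (cases "k = 1") auto
  have u_diff: "u (k + 1) - u k = t (k + 1) *\<^sub>R (x (k + 1) - extrapolate t x k)"
    and v_diff: "v (k + 1) - v k = t (k + 1) *\<^sub>R (y (k + 1) - extrapolate t y k)" if "k \<ge> 1" for k
  proof -
    have "t (k + 1) \<noteq> 0" using t1[of "k + 1"] by simp
    then show "u (k + 1) - u k = t (k + 1) *\<^sub>R (x (k + 1) - extrapolate t x k)"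
      "v (k + 1) - v k = t (k + 1) *\<^sub>R (y (k + 1) - extrapolate t y k)"
      unfolding u_succ[OF that] v_succ[OF that] u_eq[OF that] v_eq[OF that]
      by (simp_all add: scaleR_diff_extrapolate)
        (simp_all add: algebra_simps)
  qed

  \<comment> \<open>Optimality in the first subproblem\<close>
  define \<zeta> where "\<zeta> k = l (k + 1) - (\<gamma> * t (k + 1)) *\<^sub>R (B *v (v (k + 1) - v k))" for k

  define hx where "hx k = (\<lambda>z. (transpose A *v l k + df2 (extrapolate t x k)) \<bullet> z
      + \<gamma> * (t (k + 1))\<^sup>2 / 2
        * (norm (A *v (z - x k) + (1 / t (k + 1)) *\<^sub>R (A *v x k + B *v v k - b)))\<^sup>2
      + 1 / (2 * \<alpha>) * (norm (z - extrapolate t x k))\<^sup>2)" for k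
  have x_min: "is_arg_min (\<lambda>z. f1 z + ereal (hx k z)) (\<lambda>_. True) (x (k + 1))" if "k \<ge> 1" for k
    using iterates that unfolding algorithm_iterates_def hx_def by blast
  define Gx where "Gx k = (transpose A *v l k + df2 (extrapolate t x k))
      + (\<gamma> * (t (k + 1))\<^sup>2) *\<^sub>R (transpose A *v
          (A *v (x (k + 1) - x k) + (1 / t (k + 1)) *\<^sub>R (A *v x k + B *v v k - b)))
      + (1 / \<alpha>) *\<^sub>R (x (k + 1) - extrapolate t x k)" for k
  have x_exp: "hx k (x (k + 1) + s *\<^sub>R d) = hx k (x (k + 1)) + s * (Gx k \<bullet> d)
      + s\<^sup>2 * (\<gamma> * (t (k + 1))\<^sup>2 / 2 * (norm (A *v d))\<^sup>2 + 1 / \<alpha> / 2 * (norm d)\<^sup>2)" for k s d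
    unfolding Gx_def by (rule penalty_expansion) (simp add: hx_def mult.commute)
  have x_fin: "f1 (x k) < \<infinity>" if "k \<ge> 1" for k
  proof (cases "k = 1")
    case False
    with that have "k - 1 \<ge> 1" by simp
    from arg_min_subgradient(1)[OF f1(1,2,4) x_min[OF this] x_exp] that show ?thesis by simp
  qed (use x1 in simp)
  \<comment> \<open>The penalty sees \<open>u (k + 1)\<close> but still \<open>v k\<close>, so its
    gradient turns \<open>l k\<close> into \<open>\<zeta> k\<close>, which is
    \<open>l (k + 1)\<close> with the lag of \<open>v\<close> removed. The summand with factor
    \<open>0\<close> matches the form of \<open>\<xi>\<close> in \<open>accelerated_step\<close> for
    modulus \<open>0\<close>.\<close>
  have Gx: "df2 (extrapolate t x k) - Gx k = - (transpose A *v \<zeta> k)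
      - (1 / \<alpha>) *\<^sub>R (x (k + 1) - extrapolate t x k)
      - 0 *\<^sub>R (u (k + 1) - x (k + 1))" if k: "k \<ge> 1" for k
  proof -
    define T where "T = t (k + 1)"
    have T: "T > 0" using t1[of "k + 1"] by (simp add: T_def)
    have "u (k + 1) = x k + T *\<^sub>R (x (k + 1) - x k)"
      unfolding u_succ[OF k] T_def by (simp add: algebra_simps)
    then have "A *v u (k + 1) = A *v x k + T *\<^sub>R (A *v (x (k + 1) - x k))"
      by (simp only: mult_simps)
    then have "A *v (x (k + 1) - x k) + (1 / T) *\<^sub>R (A *v x k + B *v v k - b)
        = (1 / T) *\<^sub>R (A *v u (k + 1) + B *v v k - b)"
      using T by (simp add: scaleR_add_right scaleR_diff_right)
    also have "\<dots> = (1 / T) *\<^sub>R (r (k + 1) - B *v (v (k + 1) - v k))"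
      by (simp add: r_def mult_simps)
    finally have "(\<gamma> * T\<^sup>2) *\<^sub>R (transpose A *v
          (A *v (x (k + 1) - x k) + (1 / T) *\<^sub>R (A *v x k + B *v v k - b)))
        = transpose A *v ((\<gamma> * T) *\<^sub>R (r (k + 1) - B *v (v (k + 1) - v k)))"
      using T by (simp add: matrix_vector_mult_scaleR power2_eq_square)
    then show ?thesis
      unfolding Gx_def \<zeta>_def l_succ[OF k] T_def[symmetric]
      by (simp add: mult_simps algebra_simps)
  qed
  have x_bound: "\<phi> (x (k + 1)) - \<phi> z \<le> (- (transpose A *v \<zeta> k)
        - (1 / \<alpha>) *\<^sub>R (x (k + 1) - extrapolate t x k) - 0 *\<^sub>R (u (k + 1) - x (k + 1)))
          \<bullet> (x (k + 1) - z)
      - 0 / 2 * (norm (x (k + 1) - z))\<^sup>2 + Lf2 / 2 * (norm (x (k + 1) - extrapolate t x k))\<^sup>2"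
    if "k \<ge> 1" "f1 z < \<infinity>" for k z
    unfolding \<phi>_def Gx[OF that(1), symmetric]
    by (rule proximal_step[OF f1(1,2) sc f2 x_min x_exp]) (use that in auto)

  \<comment> \<open>Optimality in the second subproblem\<close>
  define \<eta> where "\<eta> = step_eta \<beta> \<mu>g t"
  have \<eta>: "1 / \<eta> k = (t (k + 1))\<^sup>2 / \<beta> + \<mu>g * (t (k + 1) - 1)" "\<eta> k > 0" for k
  proof -
    have "(t (k + 1))\<^sup>2 + \<beta> * \<mu>g * (t (k + 1) - 1) > 0"
      using t1[of "k + 1"] params \<mu>g by (intro add_pos_nonneg) auto
    then show "1 / \<eta> k = (t (k + 1))\<^sup>2 / \<beta> + \<mu>g * (t (k + 1) - 1)" "\<eta> k > 0"
      using params by (auto simp: \<eta>_def step_eta_def field_simps)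
  qed
  define zy where "zy k = extrapolate t y k
      - (\<eta> k * \<mu>g * (t (k + 1) - 1)) *\<^sub>R (extrapolate t y k - y k)" for k
  define hy where "hy k = (\<lambda>z. (transpose B *v l k + dg2 (extrapolate t y k)) \<bullet> z
      + 1 / (2 * \<eta> k) * (norm (z - extrapolate t y k
          + (\<eta> k * \<mu>g * (t (k + 1) - 1)) *\<^sub>R (extrapolate t y k - y k)))\<^sup>2
      + \<gamma> * (t (k + 1))\<^sup>2 / 2
        * (norm (B *v (z - y k) + (1 / t (k + 1)) *\<^sub>R (A *v u (k + 1) + B *v y k - b)))\<^sup>2)" for k
  have y_min: "is_arg_min (\<lambda>z. g1 z + ereal (hy k z)) (\<lambda>_. True) (y (k + 1))" if "k \<ge> 1" for k
    using iterates that unfolding algorithm_iterates_def hy_def \<eta>_def by blast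
  define Gy where "Gy k = (transpose B *v l k + dg2 (extrapolate t y k))
      + (\<gamma> * (t (k + 1))\<^sup>2) *\<^sub>R (transpose B *v
          (B *v (y (k + 1) - y k) + (1 / t (k + 1)) *\<^sub>R (A *v u (k + 1) + B *v y k - b)))
      + (1 / \<eta> k) *\<^sub>R (y (k + 1) - zy k)" for k
  have y_exp: "hy k (y (k + 1) + s *\<^sub>R d) = hy k (y (k + 1)) + s * (Gy k \<bullet> d)
      + s\<^sup>2 * (\<gamma> * (t (k + 1))\<^sup>2 / 2 * (norm (B *v d))\<^sup>2 + 1 / \<eta> k / 2 * (norm d)\<^sup>2)" for k s d
    unfolding Gy_def
    by (rule penalty_expansion) (simp add: hy_def zy_def diff_diff_eq2 diff_add_eq mult.commute)
  have y_fin: "g1 (y k) < \<infinity>" if "k \<ge> 1" for k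
  proof (cases "k = 1")
    case False
    with that have "k - 1 \<ge> 1" by simp
    from arg_min_subgradient(1)[OF g1(1,2) cvx y_min[OF this] y_exp] that show ?thesis by simp
  qed (use y1 in simp)
  \<comment> \<open>Here the penalty contains the new \<open>u (k + 1)\<close>, so its gradient
    involves the full residual \<open>r (k + 1)\<close> and produces \<open>l (k + 1)\<close>
    without correction.\<close>
  have Gy: "dg2 (extrapolate t y k) - Gy k = - (transpose B *v l (k + 1))
      - ((t (k + 1))\<^sup>2 / \<beta>) *\<^sub>R (y (k + 1) - extrapolate t y k)
      - \<mu>g *\<^sub>R (v (k + 1) - y (k + 1))" if k: "k \<ge> 1" for k
  proof -
    define T where "T = t (k + 1)"
    define yb where "yb = extrapolate t y k"
    have T: "T > 0" using t1[of "k + 1"] by (simp add: T_def)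
    have "v (k + 1) = y k + T *\<^sub>R (y (k + 1) - y k)"
      unfolding v_succ[OF k] T_def by (simp add: algebra_simps)
    then have "B *v v (k + 1) = B *v y k + T *\<^sub>R (B *v (y (k + 1) - y k))"
      by (simp only: mult_simps)
    then have "B *v (y (k + 1) - y k) + (1 / T) *\<^sub>R (A *v u (k + 1) + B *v y k - b)
        = (1 / T) *\<^sub>R r (k + 1)"
      using T by (simp add: r_def scaleR_add_right scaleR_diff_right)
    then have 1: "(\<gamma> * T\<^sup>2) *\<^sub>R (transpose B *v
          (B *v (y (k + 1) - y k) + (1 / T) *\<^sub>R (A *v u (k + 1) + B *v y k - b)))
        = transpose B *v ((\<gamma> * T) *\<^sub>R r (k + 1))"
      using T by (simp add: matrix_vector_mult_scaleR power2_eq_square)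
    \<comment> \<open>The shift of the proximal centre contributes a multiple of
      \<open>yb - y k\<close>, and the part \<open>\<mu>g * (T - 1)\<close> of
      \<open>1 / \<eta> k\<close> the same multiple of \<open>y (k + 1) - yb\<close>. In their sum
      \<open>yb\<close> cancels, which leaves \<open>\<mu>g\<close> times
      \<open>v (k + 1) - y (k + 1)\<close>.\<close>
    have "(1 / \<eta> k) *\<^sub>R (y (k + 1) - zy k)
        = (1 / \<eta> k) *\<^sub>R (y (k + 1) - yb) + (\<mu>g * (T - 1)) *\<^sub>R (yb - y k)"
      using \<eta>(2)[of k] unfolding zy_def T_def yb_def by (simp add: scaleR_diff_right)
    also have "\<dots> = (T\<^sup>2 / \<beta>) *\<^sub>R (y (k + 1) - yb) + \<mu>g *\<^sub>R ((T - 1) *\<^sub>R (y (k + 1) - y k))"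
      unfolding \<eta>(1) T_def[symmetric] by (simp add: algebra_simps)
    also have "(T - 1) *\<^sub>R (y (k + 1) - y k) = v (k + 1) - y (k + 1)"
      unfolding v_succ[OF k] T_def by simp
    finally have 2: "(1 / \<eta> k) *\<^sub>R (y (k + 1) - zy k)
        = (T\<^sup>2 / \<beta>) *\<^sub>R (y (k + 1) - yb) + \<mu>g *\<^sub>R (v (k + 1) - y (k + 1))" .
    show ?thesis
      unfolding Gy_def l_succ[OF k] T_def[symmetric] yb_def[symmetric] 1 2
      by (simp add: mult_simps)
  qed
  have y_bound: "\<psi> (y (k + 1)) - \<psi> z \<le> (- (transpose B *v l (k + 1))
        - ((t (k + 1))\<^sup>2 / \<beta>) *\<^sub>R (y (k + 1) - extrapolate t y k) - \<mu>g *\<^sub>R (v (k + 1) - y (k + 1)))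
          \<bullet> (y (k + 1) - z)
      - \<mu>g / 2 * (norm (y (k + 1) - z))\<^sup>2 + Lg2 / 2 * (norm (y (k + 1) - extrapolate t y k))\<^sup>2"
    if "k \<ge> 1" "g1 z < \<infinity>" for k z
    unfolding \<psi>_def Gy[OF that(1), symmetric]
    by (rule proximal_step[OF g1(1,2,4) g2 y_min y_exp]) (use that in auto)

  \<comment> \<open>Finiteness, feasibility of the saddle point and the Lagrangian gap\<close>
  have f_eq: "f z = ereal (\<phi> z)" if "f1 z < \<infinity>" for z
    using f1(1) that by (cases "f1 z") (auto simp: f_def \<phi>_def)
  have g_eq: "g z = ereal (\<psi> z)" if "g1 z < \<infinity>" for z
    using g1(1) that by (cases "g1 z") (auto simp: g_def \<psi>_def)
  have lag_eq: "lagrangian f g A B b z1 z2 q = ereal (\<phi> z1 + \<psi> z2 + q \<bullet> (A *v z1 + B *v z2 - b))"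
    if "f1 z1 < \<infinity>" "g1 z2 < \<infinity>" for z1 z2 q
    using that by (simp add: lagrangian_def f_eq g_eq)
  have saddle_le: "lagrangian f g A B b xs ys q \<le> lagrangian f g A B b xs ys ls"
    "lagrangian f g A B b xs ys ls \<le> lagrangian f g A B b z1 z2 ls" for z1 z2 q
    using saddle by (auto simp: saddle_points_def)
  \<comment> \<open>The saddle inequality is tested at the starting point, where the Lagrangian is
    finite.\<close>
  have "lagrangian f g A B b xs ys ls < \<infinity>"
    using saddle_le(2)[of "x 1" "y 1"] unfolding lag_eq[OF x1 y1] by auto
  then have s_fin: "f1 xs < \<infinity>" "g1 ys < \<infinity>"
    using f1(1) g1(1) by (auto simp: lagrangian_def f_def g_def)
  have feas: "A *v xs + B *v ys = b"
  proof -
    define d where "d = A *v xs + B *v ys - b"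
    \<comment> \<open>The multiplier is perturbed by the residual \<open>d\<close> itself, which
      forces its square to be nonpositive.\<close>
    have "(ls + d) \<bullet> d \<le> ls \<bullet> d"
      using saddle_le(1)[of "ls + d"] unfolding lag_eq[OF s_fin] by (simp add: d_def)
    then have "d \<bullet> d \<le> 0" by (simp add: inner_add_left)
    then have "d = 0" by (metis inner_eq_zero_iff inner_ge_zero order_antisym)
    then show ?thesis by (simp add: d_def)
  qed

  define F where "F k = \<phi> (x k) - \<phi> xs + (\<psi> (y k) - \<psi> ys) + ls \<bullet> w k" for k
  have lag_diff: "lagrangian f g A B b (x k) (y k) ls - lagrangian f g A B b xs ys ls = ereal (F k)"
    if "k \<ge> 1" for k
    unfolding lag_eq[OF x_fin[OF that] y_fin[OF that]] lag_eq[OF s_fin]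
    by (simp add: feas F_def w_def)
  have F_nonneg: "F k \<ge> 0" if "k \<ge> 1" for k
    using saddle_le(2)[of "x k" "y k"]
    unfolding lag_eq[OF x_fin[OF that] y_fin[OF that]] lag_eq[OF s_fin]
    by (simp add: feas F_def w_def)

  \<comment> \<open>Step-size bounds and the residual recursion\<close>
  have Lf2: "Lf2 \<le> 1 / \<alpha>"
  proof -
    \<comment> \<open>For \<open>Lf2 = 0\<close> the bound on \<open>\<alpha>\<close> reads
      \<open>\<infinity>\<close>, and the claim follows from \<open>\<alpha> > 0\<close>.\<close>
    have "Lf2 \<ge> 0" using f2 by (auto simp: convex_lipschitz_gradient_def lipschitz_on_def)
    then show ?thesis
      using alpha params by (cases "Lf2 = 0") (auto simp: one_ereal_def field_simps)
  qed
  have Lg2: "Lg2 \<le> (t k)\<^sup>2 / \<beta>" if "k \<ge> 1" for k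
  proof -
    have "Lg2 \<ge> 0" using g2 by (auto simp: convex_lipschitz_gradient_def lipschitz_on_def)
    then have "Lg2 \<le> (t 1)\<^sup>2 / \<beta>"
      using beta params by (cases "Lg2 = 0") (auto simp: field_simps)
    also have "t 1 \<le> t k" using t_mono that by (auto simp: mono_on_def)
    then have "(t 1)\<^sup>2 / \<beta> \<le> (t k)\<^sup>2 / \<beta>"
      using t1[of 1] params by (intro divide_right_mono power_mono) auto
    finally show ?thesis .
  qed

  \<comment> \<open>Expresses the multiplier increments through weighted residuals of the original
    iterates, with the same weights as those of the gap in \<open>accelerated_step\<close>.\<close>
  have r_eq: "t (k + 1) *\<^sub>R r (k + 1) = (t (k + 1))\<^sup>2 *\<^sub>R w (k + 1)
      - ((t (k + 1))\<^sup>2 - t (k + 1)) *\<^sub>R w k" if "k \<ge> 1" for k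
    unfolding r_def w_def u_succ[OF that] v_succ[OF that]
    by (simp add: mult_simps power2_eq_square algebra_simps)

  \<comment> \<open>Monotonicity of the Lyapunov function\<close>
  define E where "E k = (t k)\<^sup>2 * F k + 1 / \<alpha> / 2 * (norm (u k - xs))\<^sup>2
      + (t (k + 1))\<^sup>2 / \<beta> / 2 * (norm (v k - ys))\<^sup>2 + 1 / (2 * \<gamma>) * (norm (l k - ls))\<^sup>2
      + \<gamma> * (t (k + 1))\<^sup>2 / 2 * (norm (B *v (v k - ys)))\<^sup>2" for k
  have E_step: "E (k + 1) \<le> E k" if k: "k \<ge> 1" for k
  proof -
    define T where "T = t (k + 1)"
    have T: "T \<ge> 1" using t1[of "k + 1"] by (simp add: T_def)
    have X: "T\<^sup>2 * (\<phi> (x (k + 1)) - \<phi> xs) - (T\<^sup>2 - T) * (\<phi> (x k) - \<phi> xs)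
        \<le> - T * ((transpose A *v \<zeta> k) \<bullet> (u (k + 1) - xs))
          + 1 / \<alpha> / 2 * ((norm (u k - xs))\<^sup>2 - (norm (u (k + 1) - xs))\<^sup>2)
          - 0 * T / 2 * (norm (u (k + 1) - xs))\<^sup>2"
      using u_succ[OF k] u_diff[OF k] unfolding T_def[symmetric]
      by (intro accelerated_step[OF T order_refl Lf2 _ _ refl x_bound[OF k s_fin(1)]
            x_bound[OF k x_fin[OF k]]])
    \<comment> \<open>The weight \<open>T\<^sup>2 / \<beta>\<close> varies with \<open>k\<close>;
      this is why \<open>E k\<close> carries \<open>t (k + 1)\<close> in front of the distance of
      \<open>v k\<close>.\<close>
    have Y: "T\<^sup>2 * (\<psi> (y (k + 1)) - \<psi> ys) - (T\<^sup>2 - T) * (\<psi> (y k) - \<psi> ys)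
        \<le> - T * ((transpose B *v l (k + 1)) \<bullet> (v (k + 1) - ys))
          + T\<^sup>2 / \<beta> / 2 * ((norm (v k - ys))\<^sup>2 - (norm (v (k + 1) - ys))\<^sup>2)
          - \<mu>g * T / 2 * (norm (v (k + 1) - ys))\<^sup>2"
      using v_succ[OF k] v_diff[OF k] Lg2[of "k + 1"] \<mu>g
        y_bound[OF k s_fin(2)] y_bound[OF k y_fin[OF k]] unfolding T_def[symmetric]
      by (intro accelerated_step[OF T _ _ _ _ refl]) auto
    define a where "a = A *v (u (k + 1) - xs)"
    define q where "q = B *v (v k - ys)"
    define q' where "q' = B *v (v (k + 1) - ys)"
    have r': "r (k + 1) = a + q'"
      unfolding r_def a_def q'_def feas[symmetric] by (simp add: mult_simps)
    have \<zeta>: "\<zeta> k = l (k + 1) - (\<gamma> * T) *\<^sub>R (q' - q)"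
      unfolding \<zeta>_def q_def q'_def T_def by (simp add: mult_simps)
    have M: "T * (ls \<bullet> r (k + 1) - \<zeta> k \<bullet> a - l (k + 1) \<bullet> q')
        \<le> 1 / (2 * \<gamma>) * ((norm (l k - ls))\<^sup>2 - (norm (l (k + 1) - ls))\<^sup>2)
          + \<gamma> * T\<^sup>2 / 2 * ((norm q)\<^sup>2 - (norm q')\<^sup>2)"
      unfolding \<zeta> using l_succ[OF k] by (intro multiplier_step params r') (simp add: T_def)
    have W: "T\<^sup>2 * (ls \<bullet> w (k + 1)) - (T\<^sup>2 - T) * (ls \<bullet> w k) = T * (ls \<bullet> r (k + 1))"
      using arg_cong[OF r_eq[OF k], of "\<lambda>z. ls \<bullet> z"]
      by (simp add: T_def inner_diff_right)
    have "T\<^sup>2 * F (k + 1) - (T\<^sup>2 - T) * F k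
        = (T\<^sup>2 * (\<phi> (x (k + 1)) - \<phi> xs) - (T\<^sup>2 - T) * (\<phi> (x k) - \<phi> xs))
        + (T\<^sup>2 * (\<psi> (y (k + 1)) - \<psi> ys) - (T\<^sup>2 - T) * (\<psi> (y k) - \<psi> ys))
        + T * (ls \<bullet> r (k + 1))"
      unfolding W[symmetric] F_def by (simp add: algebra_simps)
    also have "\<dots> \<le> 1 / \<alpha> / 2 * ((norm (u k - xs))\<^sup>2 - (norm (u (k + 1) - xs))\<^sup>2)
          + T\<^sup>2 / \<beta> / 2 * ((norm (v k - ys))\<^sup>2 - (norm (v (k + 1) - ys))\<^sup>2)
          - \<mu>g * T / 2 * (norm (v (k + 1) - ys))\<^sup>2
          + T * (ls \<bullet> r (k + 1) - \<zeta> k \<bullet> a - l (k + 1) \<bullet> q')"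
      using X Y unfolding inner_transpose_matrix_vector a_def q'_def right_diff_distrib by simp
    finally have FF: "T\<^sup>2 * F (k + 1) - (T\<^sup>2 - T) * F k
        \<le> 1 / \<alpha> / 2 * ((norm (u k - xs))\<^sup>2 - (norm (u (k + 1) - xs))\<^sup>2)
          + T\<^sup>2 / \<beta> / 2 * ((norm (v k - ys))\<^sup>2 - (norm (v (k + 1) - ys))\<^sup>2)
          - \<mu>g * T / 2 * (norm (v (k + 1) - ys))\<^sup>2
          + 1 / (2 * \<gamma>) * ((norm (l k - ls))\<^sup>2 - (norm (l (k + 1) - ls))\<^sup>2)
          + \<gamma> * T\<^sup>2 / 2 * ((norm q)\<^sup>2 - (norm q')\<^sup>2)"
      using M by linarith
    \<comment> \<open>The first growth condition trades the weight \<open>T\<^sup>2 - T\<close> for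
      the weight \<open>(t k)\<^sup>2\<close> of \<open>E k\<close>; nonnegativity of the gap gives
      the direction.\<close>
    have "T\<^sup>2 - T \<le> (t k)\<^sup>2" using t_step1 k by (simp add: T_def algebra_simps)
    then have tF: "(T\<^sup>2 - T) * F k \<le> (t k)\<^sup>2 * F k"
      using F_nonneg[OF k] by (rule mult_right_mono)
    define N where "N = (norm (v (k + 1) - ys))\<^sup>2"
    define S where "S = (t (k + 1 + 1))\<^sup>2"
    define o2 where "o2 = (onorm ((*v) B))\<^sup>2"
    have "(norm q')\<^sup>2 \<le> (onorm ((*v) B) * norm (v (k + 1) - ys))\<^sup>2"
      unfolding q'_def by (intro power_mono onorm) auto
    then have q'_le: "(norm q')\<^sup>2 \<le> o2 * N" by (simp add: o2_def N_def power_mult_distrib)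
    have o2: "o2 \<ge> 0" and N: "N \<ge> 0" by (simp_all add: o2_def N_def)
    have den: "1 + \<beta> * \<gamma> * o2 > 0"
      using params o2 by (intro add_pos_nonneg) auto
    \<comment> \<open>Passing to \<open>E (k + 1)\<close> raises two weights from
      \<open>T\<^sup>2\<close> to \<open>S\<close>. Bounding \<open>norm q'\<close> by the operator
      norm makes the factor \<open>1 + \<beta> * \<gamma> * o2\<close> appear, which cancels the
      denominator of the second growth condition and leaves the surplus
      \<open>\<mu>g * T * N\<close>.\<close>
    have "(S - T\<^sup>2) * (N / \<beta> + \<gamma> * (norm q')\<^sup>2)
        \<le> (\<beta> * \<mu>g / (1 + \<beta> * \<gamma> * o2) * T) * (N / \<beta> + \<gamma> * (norm q')\<^sup>2)"
      using t_step2 k params N by (intro mult_right_mono) (auto simp: S_def T_def o2_def algebra_simps)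
    also have "\<dots> \<le> (\<beta> * \<mu>g / (1 + \<beta> * \<gamma> * o2) * T) * (N / \<beta> + \<gamma> * (o2 * N))"
      using q'_le T den params \<mu>g by (intro mult_left_mono add_left_mono) auto
    also have "N / \<beta> + \<gamma> * (o2 * N) = (1 + \<beta> * \<gamma> * o2) * (N / \<beta>)"
      using params by (simp add: field_simps)
    also have "\<beta> * \<mu>g / (1 + \<beta> * \<gamma> * o2) * T * ((1 + \<beta> * \<gamma> * o2) * (N / \<beta>)) = \<mu>g * T * N"
      using den params by simp
    finally have "S / \<beta> / 2 * N + \<gamma> * S / 2 * (norm q')\<^sup>2
        \<le> T\<^sup>2 / \<beta> / 2 * N + \<gamma> * T\<^sup>2 / 2 * (norm q')\<^sup>2 + \<mu>g * T / 2 * N"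
      by (simp add: algebra_simps diff_divide_distrib)
    with FF tF show ?thesis
      unfolding E_def T_def[symmetric] S_def[symmetric] N_def[symmetric]
        q_def[symmetric] q'_def[symmetric]
      by (simp only: right_diff_distrib)
  qed
  have E_le: "E k \<le> E 1" if "k \<ge> 1" for k
    using that by (induction k rule: dec_induct) (use E_step in fastforce)+

  \<comment> \<open>Decay of the Lagrangian gap\<close>
  define K where "K = E1 + \<gamma> * (t 2)\<^sup>2 / 2 * (norm (B *v (y 1 - ys)))\<^sup>2"
  \<comment> \<open>Uses \<open>u 1 = x 1\<close> and \<open>v 1 = y 1\<close>; \<open>K\<close>
    adds to \<open>E1\<close> the term of \<open>E 1\<close> that contains \<open>B\<close>.\<close>
  have E1_eq: "E 1 = K"
    unfolding E_def K_def E1_def lag_diff[OF order_refl] init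
    by (simp add: numeral_2_eq_2 mult.commute)
  have nonneg_parts: "(t k)\<^sup>2 * F k \<le> K" "1 / (2 * \<gamma>) * (norm (l k - ls))\<^sup>2 \<le> K"
    if "k \<ge> 1" for k
  proof -
    have "0 \<le> (t k)\<^sup>2 * F k" "0 \<le> 1 / \<alpha> / 2 * (norm (u k - xs))\<^sup>2"
      "0 \<le> (t (k + 1))\<^sup>2 / \<beta> / 2 * (norm (v k - ys))\<^sup>2"
      "0 \<le> 1 / (2 * \<gamma>) * (norm (l k - ls))\<^sup>2"
      "0 \<le> \<gamma> * (t (k + 1))\<^sup>2 / 2 * (norm (B *v (v k - ys)))\<^sup>2"
      using F_nonneg[OF that] params by auto
    then show "(t k)\<^sup>2 * F k \<le> K" "1 / (2 * \<gamma>) * (norm (l k - ls))\<^sup>2 \<le> K"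
      using E_le[OF that] unfolding E1_eq by (auto simp: E_def)
  qed
  have F_le: "F k \<le> K / (t k)\<^sup>2" if "k \<ge> 1" for k
    using nonneg_parts(1)[OF that] t1[OF that] by (simp add: field_simps)

  \<comment> \<open>Bounded multipliers and decay of the residual\<close>
  define R where "R = sqrt (2 * \<gamma> * K)"
  have l_le: "norm (l k - ls) \<le> R" if "k \<ge> 1" for k
    unfolding R_def using nonneg_parts(2)[OF that] params
    by (intro real_le_rsqrt) (simp add: field_simps)
  \<comment> \<open>Chosen so that \<open>r_eq\<close> becomes \<open>t (k + 1) *\<^sub>R r (k + 1)
    = h (k + 1) - (1 - c k) *\<^sub>R h k\<close>, with \<open>h\<close> the residual scaled by
    \<open>(t k)\<^sup>2\<close>.\<close>
  define c where "c k = ((t k)\<^sup>2 - (t (k + 1))\<^sup>2 + t (k + 1)) / (t k)\<^sup>2" for k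
  have c: "0 \<le> c k \<and> c k \<le> 1" if "k \<ge> 1" for k
  proof -
    have "(t (k + 1))\<^sup>2 \<le> (t k)\<^sup>2 + t (k + 1)" using t_step1 that by blast
    moreover have "t (k + 1) \<le> (t (k + 1))\<^sup>2" using t1[of "k + 1"] by (simp add: self_le_power)
    ultimately show ?thesis using t1[OF that] by (simp add: c_def)
  qed
  define h where "h k = (t k)\<^sup>2 *\<^sub>R w k" for k
  \<comment> \<open>Each single step leaves a full \<open>h k\<close> on the right; in the sum all
    of these cancel except \<open>h 1\<close>.\<close>
  have telescope: "\<gamma> *\<^sub>R (h (k + 1) + (\<Sum>j=1..k. c j *\<^sub>R h j)) = l (k + 1) - l 1 + \<gamma> *\<^sub>R h 1"
    if "k \<ge> 1" for k
  proof -
    have ch: "c k *\<^sub>R h k = ((t k)\<^sup>2 - (t (k + 1))\<^sup>2 + t (k + 1)) *\<^sub>R w k" if "k \<ge> 1" for k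
      using t1[OF that] by (simp add: c_def h_def)
    have one_step: "\<gamma> *\<^sub>R (h (k + 1) + c k *\<^sub>R h k) = l (k + 1) - l k + \<gamma> *\<^sub>R h k" if "k \<ge> 1" for k
    proof -
      have "l (k + 1) - l k = \<gamma> *\<^sub>R (t (k + 1) *\<^sub>R r (k + 1))"
        using l_succ[OF that] by simp
      then show ?thesis unfolding ch[OF that] unfolding r_eq[OF that] h_def by (simp add: algebra_simps)
    qed
    show ?thesis using that
    proof (induction k rule: dec_induct)
      case base
      show ?case using one_step[of 1] by simp
    next
      case (step k)
      have "\<gamma> *\<^sub>R (h (Suc k + 1) + (\<Sum>j=1..Suc k. c j *\<^sub>R h j))
          = \<gamma> *\<^sub>R (h (Suc k + 1) + c (Suc k) *\<^sub>R h (Suc k))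
            + \<gamma> *\<^sub>R (h (k + 1) + (\<Sum>j=1..k. c j *\<^sub>R h j)) - \<gamma> *\<^sub>R h (Suc k)"
        by (simp add: algebra_simps)
      also have "\<dots> = l (Suc k + 1) - l 1 + \<gamma> *\<^sub>R h 1"
        unfolding step.IH one_step[OF le_SucI[OF step.hyps(1)]] by simp
      finally show ?case .
    qed
  qed
  \<comment> \<open>Bounds the right-hand side of \<open>telescope\<close> divided by
    \<open>\<gamma>\<close>, after inserting \<open>ls\<close> between \<open>l (k + 1)\<close> and
    \<open>l 1\<close>.\<close>
  define D where "D = norm (h 1) + (norm (l 1 - ls) + R) / \<gamma>"
  have D: "norm (h (k + 1) + (\<Sum>j=1..k. c j *\<^sub>R h j)) \<le> D" if "k \<ge> 1" for k
  proof -
    have "\<gamma> * norm (h (k + 1) + (\<Sum>j=1..k. c j *\<^sub>R h j))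
        = norm ((l (k + 1) - ls) - (l 1 - ls) + \<gamma> *\<^sub>R h 1)"
      using arg_cong[OF telescope[OF that], of norm] params by simp
    also have "\<dots> \<le> norm (l (k + 1) - ls) + norm (l 1 - ls) + norm (\<gamma> *\<^sub>R h 1)"
      by (meson norm_triangle_ineq norm_triangle_ineq4 add_right_mono order_trans)
    also have "\<dots> \<le> R + norm (l 1 - ls) + \<gamma> * norm (h 1)"
      using l_le[of "k + 1"] params by simp
    also have "\<dots> = \<gamma> * D" using params by (simp add: D_def field_simps)
    finally show ?thesis using params by simp
  qed
  \<comment> \<open>The factor 3 in \<open>C1\<close> counts \<open>norm (h 1)\<close> once on its
    own and twice inside \<open>2 * D\<close>.\<close>
  have C1_eq: "C1 = norm (h 1) + 2 * D"
  proof -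
    have "2 * \<gamma> * E1 + \<gamma>\<^sup>2 * (t 2)\<^sup>2 * (norm (B *v (y 1 - ys)))\<^sup>2 = 2 * \<gamma> * K"
      by (simp add: K_def algebra_simps power2_eq_square)
    then show ?thesis
      unfolding C1_def D_def R_def h_def w_def by (simp add: add_divide_distrib)
  qed
  have w_le: "norm (w k) \<le> C1 / (t k)\<^sup>2" if "k \<ge> 1" for k
  proof -
    have "norm (h k) \<le> C1"
      unfolding C1_eq by (rule norm_bound_of_weighted_sums[OF c D that])
    then show ?thesis using t1[OF that] by (simp add: h_def field_simps)
  qed

  \<comment> \<open>The three estimates\<close>
  show ?thesis
  proof (intro allI impI conjI)
    fix k :: nat
    assume k: "k \<ge> 1"
    show "lagrangian f g A B b (x k) (y k) ls - lagrangian f g A B b xs ys ls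
        \<le> ereal ((E1 + \<gamma> * (t 2)\<^sup>2 / 2 * (norm (B *v (y 1 - ys)))\<^sup>2) / (t k)\<^sup>2)"
      using F_le[OF k] by (simp add: lag_diff[OF k] K_def)
    show "norm (A *v x k + B *v y k - b) \<le> C1 / (t k)\<^sup>2"
      using w_le[OF k] by (simp add: w_def)
    have "\<bar>ls \<bullet> w k\<bar> \<le> norm ls * norm (w k)" by (rule Cauchy_Schwarz_ineq2)
    also have "\<dots> \<le> norm ls * (C1 / (t k)\<^sup>2)" using w_le[OF k] by (rule mult_left_mono) simp
    finally have "\<bar>ls \<bullet> w k\<bar> \<le> C1 * norm ls / (t k)\<^sup>2" by (simp add: mult.commute)
    \<comment> \<open>\<open>F k - ls \<bullet> w k\<close> is the difference of the objective
      values, so its bound is the gap bound plus \<open>norm ls\<close> times the residual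
      bound.\<close>
    then have "\<bar>F k - ls \<bullet> w k\<bar> \<le> K / (t k)\<^sup>2 + C1 * norm ls / (t k)\<^sup>2"
      using F_le[OF k] F_nonneg[OF k] by linarith
    moreover have "f (x k) + g (y k) - f xs - g ys = ereal (F k - ls \<bullet> w k)"
      unfolding f_eq[OF x_fin[OF k]] g_eq[OF y_fin[OF k]] f_eq[OF s_fin(1)] g_eq[OF s_fin(2)]
      by (simp add: F_def)
    ultimately show "\<bar>f (x k) + g (y k) - f xs - g ys\<bar>
        \<le> ereal ((E1 + \<gamma> * (t 2)\<^sup>2 / 2 * (norm (B *v (y 1 - ys)))\<^sup>2 + C1 * norm ls) / (t k)\<^sup>2)"
      by (simp add: K_def add_divide_distrib)
  qed
qed

end
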